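(* Let $d$ be a positive integer and let $p_0^d(z) = d!\left(\binom{z+d}{d}+\binom{z}{d}\right)$. Let $f$ be a $CL$-polynomial of degree $d$ that satisfies $(\diamondsuit)$, i.e. whose $h^*$-polynomial has palindromic and non-negative coefficients. Then every root $-\frac12+\alpha\sqrt{-1}$ (with $\alpha\in\mathbb{R}$) of $f$ satisfies $\alpha\leq\tilde{\alpha}_d$, where $$\tilde{\alpha}_d=\max\left\{ \beta\in\mathbb{R} : -\tfrac12+\beta\sqrt{-1}\text{ is a root of }p_0^d \right\}.$$
   Context: The critical line is $CL=\{z\in\mathbb{C} : \mathrm{Re}(z)=-\frac12\}$. A $CL$-polynomial of degree $d$ is a polynomial of the form $f(z)=b(z)\prod_{i=0}^{\lfloor d/2\rfloor-1}(z^2+z+c_i)$, where the $c_i$ are real numbers $\geq\frac14$ and, for a non-zero constant $a$, $b(z)=a$ if $d$ is even and $b(z)=a(2z+1)$ if $d$ is odd. Its roots all lie on $CL$. For a polynomial $f$ of degree $d$, the $h^*$-polynomial is the polynomial $h^*(t)=\sum_{i=0}^d h^*_i t^i$ with $\sum_{k\ge 0} f(k)t^k=\frac{h^*(t)}{(1-t)^{d+1}}$; equivalently $f(z)=\sum_{i=0}^d h_i^*\binom{z+d-i}{d}$. Here $\binom{x}{d}=\frac{x(x-1)\cdots(x-d+1)}{d!}$. Palindromic means $h^*_i=h^*_{d-i}$ for all $0\le i\le d$. Property $(\diamondsuit)$ means that all $h^*_i$ are real and $\ge 0$ and that $h^*$ is palindromic. *)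

theory Defs
  imports "HOL-Analysis.Analysis" "HOL-Computational_Algebra.Polynomial_FPS"
begin

definition CL_polynomial :: "nat \<Rightarrow> complex poly \<Rightarrow> bool" where
  "CL_polynomial d f \<longleftrightarrow>
     (\<exists>(a::complex) (c::nat \<Rightarrow> real).
        a \<noteq> 0 \<and> (\<forall>i < d div 2. c i \<ge> 1/4) \<and>
        f = (if even d then [:a:] else smult a [:1, 2:]) *
            (\<Prod>i < d div 2. [:complex_of_real (c i), 1, 1:]))"

definition hstar :: "complex poly \<Rightarrow> complex poly" where
  "hstar f = (THE h. degree h \<le> degree f \<and>
     Abs_fps (\<lambda>k. poly f (of_nat k)) = fps_of_poly h / (1 - fps_X) ^ (degree f + 1))"

definition palindromic_nonneg_hstar :: "complex poly \<Rightarrow> bool" where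
  "palindromic_nonneg_hstar f \<longleftrightarrow>
     (\<forall>i \<le> degree f. coeff (hstar f) i \<in> \<real> \<and> Re (coeff (hstar f) i) \<ge> 0) \<and>
     (\<forall>i \<le> degree f. coeff (hstar f) i = coeff (hstar f) (degree f - i))"

definition p0 :: "nat \<Rightarrow> complex \<Rightarrow> complex" where
  "p0 d z = fact d * (((z + of_nat d) gchoose d) + (z gchoose d))"

definition alpha_tilde :: "nat \<Rightarrow> real" where
  "alpha_tilde d = Max {\<beta>::real. p0 d (- 1/2 + of_real \<beta> * \<i>) = 0}"

text \<open>The description in \<open>hstar\<close> determines a unique polynomial.\<close>

lemma hstar_exists:
  fixes f :: "complex poly"
  assumes "degree f \<le> n"
  shows "\<exists>h. degree h \<le> n \<and>
    Abs_fps (\<lambda>k. poly f (of_nat k)) * (1 - fps_X) ^ (n + 1) = fps_of_poly h"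
  using assms
proof (induction n arbitrary: f)
  case 0
  then obtain a where f: "f = [:a:]" by (metis degree_eq_zeroE le_zero_eq)
  have "Abs_fps (\<lambda>k. poly f (of_nat k)) * (1 - fps_X) = fps_of_poly [:a:]"
    by (rule fps_ext) (auto simp: f algebra_simps fps_of_poly_const fps_const_def)
  then show ?case by (intro exI[of _ "[:a:]"]) simp
next
  case (Suc n)
  define g where "g = f - pcompose f [:-1, 1:]"
  have "degree g \<le> n"
  proof (cases "degree f = 0")
    case True
    then obtain a where "f = [:a:]" by (metis degree_eq_zeroE)
    then show ?thesis by (simp add: g_def)
  next
    case False
    have dp: "degree (pcompose f [:-1, 1:]) = degree f" by (simp add: degree_pcompose)
    have "lead_coeff (pcompose f [:-1, 1:]) = lead_coeff f" by (subst lead_coeff_comp) auto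
    then have "coeff g (degree f) = 0" by (simp add: g_def dp)
    moreover have "degree g \<le> degree f" unfolding g_def using dp by (metis degree_diff_le order_refl)
    ultimately have "degree g < degree f"
      using False by (metis degree_0 eq_zero_or_degree_less gr0I)
    then show ?thesis using Suc.prems by linarith
  qed
  from Suc.IH[OF this] obtain h where h: "degree h \<le> n"
    "Abs_fps (\<lambda>k. poly g (of_nat k)) * (1 - fps_X) ^ (n + 1) = fps_of_poly h" by blast
  define c where "c = poly f (-1)"
  have step: "Abs_fps (\<lambda>k. poly f (of_nat k)) * (1 - fps_X)
      = Abs_fps (\<lambda>k. poly g (of_nat k)) + fps_const c"
  proof (rule fps_ext)
    fix k
    show "fps_nth (Abs_fps (\<lambda>k. poly f (of_nat k)) * (1 - fps_X)) k
      = fps_nth (Abs_fps (\<lambda>k. poly g (of_nat k)) + fps_const c) k"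
      by (cases k) (auto simp: algebra_simps g_def poly_pcompose c_def)
  qed
  have one: "(1 - fps_X :: complex fps) = fps_of_poly [:1, -1:]"
    by (simp add: fps_of_poly_pCons)
  have "Abs_fps (\<lambda>k. poly f (of_nat k)) * (1 - fps_X) ^ (Suc n + 1)
      = (Abs_fps (\<lambda>k. poly f (of_nat k)) * (1 - fps_X)) * (1 - fps_X) ^ (n + 1)"
    by (simp add: mult.assoc)
  also have "\<dots> = fps_of_poly h + fps_const c * (1 - fps_X) ^ (n + 1)"
    unfolding step using h(2) by (simp add: distrib_right)
  also have "\<dots> = fps_of_poly (h + smult c ([:1, -1:] ^ (n + 1)))"
    unfolding one by (simp only: fps_of_poly_add fps_of_poly_smult fps_of_poly_power)
  finally have eq: "Abs_fps (\<lambda>k. poly f (of_nat k)) * (1 - fps_X) ^ (Suc n + 1)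
      = fps_of_poly (h + smult c ([:1, -1:] ^ (n + 1)))" .
  have "degree ([:1, -1:] ^ (n + 1) :: complex poly) \<le> Suc n"
    using degree_power_le[of "[:1, -1:] :: complex poly" "n + 1"] by simp
  then have "degree (h + smult c ([:1, -1:] ^ (n + 1))) \<le> Suc n"
    using h(1) by (intro degree_add_le) (auto intro: order_trans[OF degree_smult_le])
  with eq show ?case by blast
qed

lemma hstar_properties:
  shows "degree (hstar f) \<le> degree f"
    and "Abs_fps (\<lambda>k. poly f (of_nat k)) = fps_of_poly (hstar f) / (1 - fps_X) ^ (degree f + 1)"
proof -
  let ?F = "Abs_fps (\<lambda>k. poly f (of_nat k))"
  let ?U = "(1 - fps_X) ^ (degree f + 1) :: complex fps"
  have U: "?U \<noteq> 0" "is_unit ?U" by (auto simp: fps_is_unit_iff fps_nth_power_0)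
  have iff: "?F = fps_of_poly h / ?U \<longleftrightarrow> ?F * ?U = fps_of_poly h" for h
    using U by (metis dvd_div_mult_self nonzero_mult_div_cancel_right unit_imp_dvd)
  have "\<exists>!h. degree h \<le> degree f \<and> ?F = fps_of_poly h / ?U"
    unfolding iff using hstar_exists[of f "degree f"] by (metis fps_of_poly_eq_iff order_refl)
  from theI'[OF this]
  show "degree (hstar f) \<le> degree f" "?F = fps_of_poly (hstar f) / ?U"
    unfolding hstar_def by auto
qed

text \<open>The set in \<open>alpha_tilde\<close> is finite and nonempty, so its \<open>Max\<close> is a genuine maximum.\<close>

lemma p0_prod: "p0 d z = (\<Prod>i<d. z + of_nat (Suc i)) + (\<Prod>i<d. z - of_nat i)"
proof -
  have "(\<Prod>i<d. z + of_nat d - of_nat i) = (\<Prod>i<d. z + of_nat (Suc i))"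
    by (rule prod.reindex_bij_witness[of _ "\<lambda>i. d - Suc i" "\<lambda>i. d - Suc i"])
       (auto simp: of_nat_diff algebra_simps)
  then show ?thesis
    by (simp add: p0_def gbinomial_prod_rev atLeast0LessThan distrib_left)
qed

lemma p0_roots_nonempty:
  assumes "d > 0"
  shows "{\<beta>::real. p0 d (- 1/2 + of_real \<beta> * \<i>) = 0} \<noteq> {}"
proof -
  define T where "T = (\<lambda>\<beta>::real. \<Sum>i<d. arctan (\<beta> / (real i + 1/2)))"
  have "(T \<longlongrightarrow> (\<Sum>i<d. pi/2)) at_top"
    unfolding T_def
  proof (rule tendsto_sum)
    fix i
    have "filterlim (\<lambda>\<beta>. \<beta> / (real i + 1/2)) at_top at_top"
    proof -
      have "LIM \<beta> at_top. inverse (real i + 1/2) * \<beta> :> at_top"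
        by (rule filterlim_tendsto_pos_mult_at_top[OF tendsto_const _ filterlim_ident])
           (rule positive_imp_inverse_positive, linarith)
      then show ?thesis by (simp only: divide_inverse mult.commute)
    qed
    then show "((\<lambda>\<beta>. arctan (\<beta> / (real i + 1/2))) \<longlongrightarrow> pi/2) at_top"
      by (rule filterlim_compose[OF tendsto_arctan_at_top])
  qed
  then have "eventually (\<lambda>\<beta>. T \<beta> > (real d - 1) * pi/2) at_top"
    by (rule order_tendstoD) (simp add: field_simps)
  then have "eventually (\<lambda>\<beta>. T \<beta> > (real d - 1) * pi/2 \<and> \<beta> \<ge> 0) at_top"
    using eventually_ge_at_top by (rule eventually_conj)
  then obtain b where b: "T b > (real d - 1) * pi/2" "b \<ge> 0"
    unfolding eventually_at_top_linorder by blast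
  have "\<exists>x. 0 \<le> x \<and> x \<le> b \<and> T x = (real d - 1) * pi/2"
  proof (rule IVT')
    show "T 0 \<le> (real d - 1) * pi/2" using assms by (simp add: T_def)
    show "continuous_on {0..b} T" unfolding T_def by (intro continuous_intros) auto
  qed (use b in auto)
  then obtain x where x: "T x = (real d - 1) * pi/2" by blast
  define z where "z = - 1/2 + of_real x * \<i>"
  define r where "r = (\<lambda>i. (real i + 1/2) / cos (arctan (x / (real i + 1/2))))"
  have fac: "z + of_nat (Suc i) = of_real (r i) * cis (arctan (x / (real i + 1/2)))" for i
  proof -
    let ?t = "arctan (x / (real i + 1/2))"
    have c: "cos ?t \<noteq> 0" by (rule cos_arctan_not_zero)
    have "sin ?t / cos ?t = x / (real i + 1/2)" using tan_arctan by (simp add: tan_def)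
    moreover have "real i + 1/2 \<noteq> 0" by linarith
    ultimately have "r i * sin ?t = x" unfolding r_def by (metis nonzero_mult_div_cancel_left times_divide_eq_left times_divide_eq_right)
    moreover have "r i * cos ?t = real i + 1/2" unfolding r_def using c by simp
    ultimately show ?thesis by (simp add: complex_eq_iff z_def)
  qed
  define R where "R = (\<Prod>i<d. r i)"
  have cis_prod: "(\<Prod>i<n. cis (g i)) = cis (\<Sum>i<n. g i)" for g :: "nat \<Rightarrow> real" and n
    by (induction n) (simp_all add: cis_mult)
  have P: "(\<Prod>i<d. z + of_nat (Suc i)) = of_real R * cis (T x)"
    unfolding fac prod.distrib cis_prod R_def T_def of_real_prod ..
  have neg: "z - of_nat i = (-1) * cnj (z + of_nat (Suc i))" for i
    by (simp add: complex_eq_iff z_def)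
  have "(\<Prod>i<d. z - of_nat i) = (-1) ^ d * cnj (\<Prod>i<d. z + of_nat (Suc i))"
    unfolding neg prod.distrib cnj_prod by simp
  then have Q: "(\<Prod>i<d. z - of_nat i) = (-1) ^ d * (of_real R * cis (- T x))"
    unfolding P by (simp add: cis_cnj)
  have m1: "(-1::complex) ^ d = cis (real d * pi)"
    using Complex.DeMoivre[of pi d] by simp
  have "cis (T x) + cis (real d * pi) * cis (- T x) = 0"
  proof -
    have "real d * pi + - T x = T x + pi" using x by (simp add: field_simps)
    then have "cis (real d * pi) * cis (- T x) = cis (T x + pi)" by (simp only: cis_mult)
    also have "\<dots> = - cis (T x)" by (simp only: cis_mult[symmetric] cis_pi) simp
    finally show ?thesis by simp
  qed
  then have "p0 d z = 0"
    unfolding p0_prod P Q m1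
    by (simp only: mult.left_commute[of _ "of_real R"] distrib_left[symmetric] mult_zero_right)
  then show ?thesis unfolding z_def by blast
qed

lemma p0_roots_finite:
  assumes "d > 0"
  shows "finite {\<beta>::real. p0 d (- 1/2 + of_real \<beta> * \<i>) = 0}"
proof -
  define q where "q = (\<Prod>i<d. [:of_nat (Suc i), 1:]) + (\<Prod>i<d. [:- of_nat i, 1 :: complex:])"
  have q: "poly q z = p0 d z" for z
    by (simp add: q_def p0_prod poly_prod add.commute)
  have "poly q (of_nat d) \<noteq> 0"
  proof -
    have "p0 d (of_nat d) = of_real ((\<Prod>i<d. real d + real (Suc i)) + (\<Prod>i<d. real d - real i))"
      by (simp add: p0_prod)
    moreover have "(\<Prod>i<d. real d + real (Suc i)) + (\<Prod>i<d. real d - real i) > 0"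
      by (intro add_pos_pos prod_pos) auto
    ultimately show ?thesis by (metis q of_real_eq_0_iff less_irrefl)
  qed
  then have "q \<noteq> 0" by auto
  then have "finite {z. poly q z = 0}" by (rule poly_roots_finite)
  then have "finite ((\<lambda>\<beta>. - 1/2 + of_real \<beta> * \<i>) -` {z. p0 d z = 0})"
    by (intro finite_vimageI) (auto simp: q inj_def)
  then show ?thesis by (simp add: vimage_def)
qed

end

theory Submission
  imports Defs
begin

text \<open>
  On the upper critical line every factor \<open>z + x\<close> with real \<open>x\<close> is \<open>\<i>\<close> times a number in the
  right half plane, so \<open>\<i> ^ (- d)\<close> times the basis polynomial \<open>binom (z + d - i) d\<close> has an
  argument which is a sum of \<open>d\<close> arctangents. This sum decreases in \<open>i\<close>, and its values at
  \<open>i = 0\<close> and \<open>i = d\<close> are opposite. Above the largest root of \<open>p\<^sub>0\<close> the value at \<open>i = 0\<close> is less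
  than \<open>\<pi>/2\<close>. Hence all basis polynomials have positive real part after division by \<open>\<i> ^ d\<close>, and
  no nontrivial nonnegative combination of them vanishes there.
\<close>

section \<open>Expansion of a polynomial in the binomial basis\<close>

lemma fps_choose_mult_one_minus_power:
  "Abs_fps (\<lambda>n. of_nat ((n + d) choose d)) * (1 - fps_X) ^ (d + 1) = (1 :: 'a::comm_ring_1 fps)"
proof (induction d)
  case 0
  show ?case by (rule fps_ext) (auto simp: algebra_simps)
next
  case (Suc d)
  \<comment> \<open>Multiplying by \<open>1 - fps_X\<close> subtracts the preceding coefficient, so
    this is Pascal's rule.\<close>
  have "Abs_fps (\<lambda>n. of_nat ((n + Suc d) choose Suc d)) * (1 - fps_X)
      = (Abs_fps (\<lambda>n. of_nat ((n + d) choose d)) :: 'a fps)"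
  proof (rule fps_ext)
    fix n
    show "fps_nth (Abs_fps (\<lambda>n. of_nat ((n + Suc d) choose Suc d)) * (1 - fps_X)) n
      = fps_nth (Abs_fps (\<lambda>n. of_nat ((n + d) choose d)) :: 'a fps) n"
      by (cases n) (auto simp: algebra_simps binomial_eq_0)
  qed
  then have "Abs_fps (\<lambda>n. of_nat ((n + Suc d) choose Suc d)) * (1 - fps_X) ^ (Suc d + 1)
      = (Abs_fps (\<lambda>n. of_nat ((n + d) choose d)) :: 'a fps) * (1 - fps_X) ^ (d + 1)"
    by (simp flip: mult.assoc)
  then show ?case using Suc.IH by simp
qed

text \<open>The series for 1 / (1 - X)^(d+1) has binomial coefficients, so the defining quotient of
  \<open>hstar f\<close> becomes a Cauchy product.\<close>

lemma poly_of_nat_eq_sum_hstar: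
  "poly f (of_nat k) = (\<Sum>i\<le>degree f. coeff (hstar f) i * ((of_nat k + of_nat (degree f) - of_nat i) gchoose degree f))"
proof -
  define d where "d = degree f"
  let ?F = "Abs_fps (\<lambda>k. poly f (of_nat k))"
  let ?U = "(1 - fps_X) ^ (d + 1) :: complex fps"
  let ?B = "Abs_fps (\<lambda>n. of_nat ((n + d) choose d)) :: complex fps"
  have BU: "?B * ?U = 1" by (rule fps_choose_mult_one_minus_power)
  have "fps_of_poly (hstar f) = (fps_of_poly (hstar f) * ?B) * ?U"
    by (simp only: mult.assoc BU mult_1_right)
  moreover have "?U \<noteq> 0" using BU by auto
  ultimately have "fps_of_poly (hstar f) / ?U = fps_of_poly (hstar f) * ?B"
    by (metis nonzero_mult_div_cancel_right)
  then have "?F = fps_of_poly (hstar f) * ?B"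
    using hstar_properties(2)[of f] by (simp add: d_def)
  then have "fps_nth ?F k = fps_nth (fps_of_poly (hstar f) * ?B) k" by simp
  then have "poly f (of_nat k) = (\<Sum>i\<le>k. coeff (hstar f) i * of_nat ((k - i + d) choose d))"
    by (simp add: fps_mult_nth atLeast0AtMost)
  also have "\<dots> = (\<Sum>i\<le>k. coeff (hstar f) i * ((of_nat k + of_nat d - of_nat i) gchoose d))"
    by (intro sum.cong refl) (simp add: binomial_gbinomial of_nat_diff algebra_simps)
  \<comment> \<open>The range is first widened only to \<open>k + d\<close>: up to there the upper
    argument \<open>k + d - i\<close> is a natural number, and for \<open>i > k\<close> it is below
    \<open>d\<close>, so the new terms vanish. Beyond it the argument would be negative. The degree
    bound on \<open>hstar f\<close> then cuts the range to \<open>d\<close>.\<close>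
  also have "\<dots> = (\<Sum>i\<le>k + d. coeff (hstar f) i * ((of_nat k + of_nat d - of_nat i) gchoose d))"
  proof (rule sum.mono_neutral_left)
    show "\<forall>i\<in>{..k + d} - {..k}. coeff (hstar f) i * ((of_nat k + of_nat d - of_nat i) gchoose d) = 0"
    proof
      fix i assume i: "i \<in> {..k + d} - {..k}"
      then have "(of_nat k + of_nat d - of_nat i :: complex) = of_nat (k + d - i)"
        by (simp add: of_nat_diff)
      moreover have "(k + d - i) choose d = 0" using i by (intro binomial_eq_0) auto
      ultimately show "coeff (hstar f) i * ((of_nat k + of_nat d - of_nat i) gchoose d) = 0"
        by (metis binomial_gbinomial mult_zero_right of_nat_0)
    qed
  qed auto
  also have "\<dots> = (\<Sum>i\<le>d. coeff (hstar f) i * ((of_nat k + of_nat d - of_nat i) gchoose d))"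
  proof (rule sum.mono_neutral_right)
    show "\<forall>i\<in>{..k + d} - {..d}. coeff (hstar f) i * ((of_nat k + of_nat d - of_nat i) gchoose d) = 0"
      using hstar_properties(1)[of f] by (auto simp: d_def coeff_eq_0)
  qed auto
  finally show ?thesis by (simp add: d_def)
qed

text \<open>Both sides are polynomial in \<open>z\<close> (\<open>g\<close> is the right one) and
  agree at infinitely many points, the naturals.\<close>

lemma poly_eq_sum_hstar:
  "poly f z = (\<Sum>i\<le>degree f. coeff (hstar f) i * ((z + of_nat (degree f) - of_nat i) gchoose degree f))"
proof -
  define d where "d = degree f"
  define g where "g = (\<Sum>i\<le>d. smult (coeff (hstar f) i / fact d)
      (\<Prod>j<d. [:of_nat d - of_nat i - of_nat j, 1:]))"
  have g: "poly g w = (\<Sum>i\<le>d. coeff (hstar f) i * ((w + of_nat d - of_nat i) gchoose d))" for w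
    unfolding g_def gbinomial_prod_rev
    by (simp add: poly_sum poly_prod atLeast0LessThan algebra_simps)
  have "poly (f - g) (of_nat k) = 0" for k
    using poly_of_nat_eq_sum_hstar[of f k] by (simp add: g flip: d_def)
  then have "range of_nat \<subseteq> {w. poly (f - g) w = 0}" by blast
  moreover have "infinite (range (of_nat :: nat \<Rightarrow> complex))"
    by (rule range_inj_infinite) (rule inj_of_nat)
  ultimately have "f - g = 0" using poly_roots_finite finite_subset by blast
  then show ?thesis using g by (simp add: d_def)
qed

lemma CL_polynomial_degree:
  assumes "CL_polynomial d f"
  shows "degree f = d" "f \<noteq> 0"
proof -
  obtain a c where a: "a \<noteq> 0"
    and f: "f = (if even d then [:a:] else smult a [:1, 2:]) *
            (\<Prod>i < d div 2. [:complex_of_real (c i), 1, 1:])"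
    using assms unfolding CL_polynomial_def by blast
  have P: "degree (\<Prod>i < d div 2. [:complex_of_real (c i), 1, 1:]) = 2 * (d div 2)"
    by (subst degree_prod_sum_eq) auto
  have P0: "(\<Prod>i < d div 2. [:complex_of_real (c i), 1, 1:]) \<noteq> 0"
    by (simp add: prod_zero_iff)
  show "degree f = d" "f \<noteq> 0"
    using a P P0 by (auto simp: f degree_mult_eq)
qed

section \<open>Arguments of the basis polynomials on the upper critical line\<close>

lemma cis_sum: "finite A \<Longrightarrow> cis (\<Sum>i\<in>A. g i) = (\<Prod>i\<in>A. cis (g i))"
  by (induction A rule: finite_induct) (simp_all flip: cis_mult)

text \<open>The angle is measured from the imaginary axis: the left side is \<i> * (a - \<i> y), and
  a - \<i> y lies in the right half plane with argument -arctan (y / a).\<close>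

lemma of_real_plus_ii_polar:
  fixes a y :: real
  assumes "a > 0"
  shows "of_real y + of_real a * \<i>
    = \<i> * of_real (a / cos (arctan (y / a))) * cis (- arctan (y / a))"
proof -
  let ?t = "arctan (y / a)"
  have c: "cos ?t \<noteq> 0" by (rule cos_arctan_not_zero)
  have "sin ?t / cos ?t = y / a" using tan_arctan by (simp add: tan_def)
  then have "a / cos ?t * sin ?t = y" using assms c by (simp add: field_simps)
  then show ?thesis using c by (simp add: complex_eq_iff)
qed

text \<open>The polar forms of the \<open>d\<close> linear factors are multiplied; the factor with
  index \<open>j\<close> has real part \<open>x - j - 1/2\<close>. Only the sign of the modulus
  \<open>R\<close> matters later.\<close>

lemma gbinomial_critical_line:
  fixes a x :: real
  assumes "a > 0"
  obtains R where "R > 0"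
    "(- 1/2 + of_real a * \<i> + of_real x) gchoose d
      = \<i> ^ d * of_real R * cis (- (\<Sum>j<d. arctan ((x - real j - 1/2) / a)))"
proof
  let ?t = "\<lambda>j. arctan ((x - real j - 1/2) / a)"
  let ?R = "(\<Prod>j<d. a / cos (?t j)) / fact d"
  have "cos (?t j) > 0" for j
    by (intro cos_gt_zero_pi arctan_lbound arctan_ubound)
  then show "?R > 0" using assms by (intro divide_pos_pos prod_pos) auto
  have "(\<Prod>j<d. - 1/2 + of_real a * \<i> + of_real x - of_nat j)
      = (\<Prod>j<d. \<i> * of_real (a / cos (?t j)) * cis (- ?t j))"
    by (intro prod.cong refl, subst of_real_plus_ii_polar[OF assms, symmetric]) simp
  also have "\<dots> = \<i> ^ d * of_real (\<Prod>j<d. a / cos (?t j)) * cis (\<Sum>j<d. - ?t j)"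
    by (simp only: prod.distrib prod_constant card_lessThan of_real_prod cis_sum finite_lessThan)
  finally show "(- 1/2 + of_real a * \<i> + of_real x) gchoose d
      = \<i> ^ d * of_real ?R * cis (- (\<Sum>j<d. ?t j))"
    by (simp add: gbinomial_prod_rev atLeast0LessThan sum_negf)
qed

lemma sum_arctan_reverse:
  "(\<Sum>j<d. arctan ((real d - real j - 1/2) / a)) = (\<Sum>j<d. arctan ((real j + 1/2) / a))"
  by (rule sum.reindex_bij_witness[of _ "\<lambda>j. d - Suc j" "\<lambda>j. d - Suc j"])
     (auto simp: of_nat_diff algebra_simps)

lemma sum_arctan_negate:
  "(\<Sum>j<d. arctan ((- real j - 1/2) / a)) = - (\<Sum>j<d. arctan ((real j + 1/2) / a))"
proof -
  have "(- real j - 1/2) / a = - ((real j + 1/2) / a)" for j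
    by (metis add_uminus_conv_diff minus_add_distrib minus_divide_left)
  then show ?thesis by (simp only: arctan_minus sum_negf)
qed

text \<open>The reflection z -> -1 - z is conjugation on the critical line, so the second product in
  \<open>p0\<close> is (-1)^d times the conjugate of the first. When the angle sum is pi/2, the
  first divided by \<i>^d is purely imaginary, and the two cancel.\<close>

lemma p0_eq_zero_if_sum_arctan:
  fixes b :: real
  assumes "b > 0" and eq: "(\<Sum>j<d. arctan ((real j + 1/2) / b)) = pi / 2"
  shows "p0 d (- 1/2 + of_real b * \<i>) = 0"
proof -
  define z where "z = - 1/2 + of_real b * \<i>"
  have neg: "z - of_nat i = (-1) * cnj (z + of_nat (Suc i))" for i
    by (simp add: complex_eq_iff z_def)
  have Q: "(\<Prod>i<d. z - of_nat i) = (-1) ^ d * cnj (\<Prod>i<d. z + of_nat (Suc i))"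
    unfolding neg prod.distrib cnj_prod by simp
  have pr: "(\<Prod>i<d. z + of_nat (Suc i)) = fact d * ((z + of_nat d) gchoose d)"
  proof -
    have "(\<Prod>i<d. z + of_nat d - of_nat i) = (\<Prod>i<d. z + of_nat (Suc i))"
      by (rule prod.reindex_bij_witness[of _ "\<lambda>i. d - Suc i" "\<lambda>i. d - Suc i"])
         (auto simp: of_nat_diff algebra_simps)
    then show ?thesis by (simp add: gbinomial_prod_rev atLeast0LessThan)
  qed
  obtain R where "(z + of_real (real d)) gchoose d
      = \<i> ^ d * of_real R * cis (- (\<Sum>j<d. arctan ((real d - real j - 1/2) / b)))"
    using gbinomial_critical_line[OF assms(1), of "real d" d] unfolding z_def by metis
  then have R: "(z + of_nat d) gchoose d = \<i> ^ d * of_real R * (- \<i>)"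
    unfolding sum_arctan_reverse eq by (simp add: complex_eq_iff flip: cis_cnj)
  have "(-1) ^ d * cnj (\<i> ^ d) = \<i> ^ d"
    by (simp flip: power_mult_distrib)
  then have "(\<Prod>i<d. z + of_nat (Suc i)) + (\<Prod>i<d. z - of_nat i)
      = fact d * of_real R * (\<i> ^ d * (- \<i>) + \<i> ^ d * \<i>)"
    unfolding Q pr R by (simp add: algebra_simps)
  then show ?thesis by (simp add: p0_prod z_def)
qed

section \<open>The arctangent sum above the largest root of \<open>p0\<close>\<close>

lemma p0_root_le_alpha_tilde:
  assumes "d > 0" "p0 d (- 1/2 + of_real b * \<i>) = 0"
  shows "b \<le> alpha_tilde d"
  unfolding alpha_tilde_def using assms p0_roots_finite by (intro Max_ge) auto

text \<open>Since \<open>p0\<close> is real, its roots come in conjugate pairs, so \<open>b\<close>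
  and \<open>- b\<close> both occur. This secures the positive imaginary part that the polar forms
  require.\<close>

lemma alpha_tilde_nonneg:
  assumes "d > 0"
  shows "alpha_tilde d \<ge> 0"
proof -
  obtain b where b: "p0 d (- 1/2 + of_real b * \<i>) = 0"
    using p0_roots_nonempty[OF assms] by blast
  have "p0 d (cnj z) = cnj (p0 d z)" for z
    by (simp add: p0_prod)
  moreover have "- 1/2 + of_real (- b) * \<i> = cnj (- 1/2 + of_real b * \<i>)"
    by (simp add: complex_eq_iff)
  ultimately have "p0 d (- 1/2 + of_real (- b) * \<i>) = 0"
    using b by (metis complex_cnj_zero)
  then show ?thesis
    using p0_root_le_alpha_tilde[OF assms b] p0_root_le_alpha_tilde[OF assms, of "- b"] by linarith
qed

text \<open>The sum tends to 0 as \<open>a\<close> grows. If it were at least pi/2 at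
  \<open>a\<close>, it would equal pi/2 at some \<open>b\<close> with b \<ge> a, and
  \<open>b\<close> would give a root of \<open>p0\<close> above the maximum.\<close>

lemma sum_arctan_less_above_alpha_tilde:
  assumes "d > 0" "a > alpha_tilde d"
  shows "(\<Sum>j<d. arctan ((real j + 1/2) / a)) < pi / 2"
proof (rule ccontr)
  define T where "T = (\<lambda>b::real. \<Sum>j<d. arctan ((real j + 1/2) / b))"
  assume "\<not> ?thesis"
  then have Ta: "T a \<ge> pi / 2" by (simp add: T_def)
  have a: "a > 0" using assms alpha_tilde_nonneg[of d] by linarith
  have "(T \<longlongrightarrow> (\<Sum>j<d. arctan 0)) at_top"
    unfolding T_def
    by (intro tendsto_sum tendsto_arctan real_tendsto_divide_at_top[OF tendsto_const filterlim_ident])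
  then have "(T \<longlongrightarrow> 0) at_top" by simp
  then have "eventually (\<lambda>b. T b < pi / 2) at_top"
    by (rule order_tendstoD) simp
  then have "eventually (\<lambda>b. T b < pi / 2 \<and> b \<ge> a) at_top"
    using eventually_ge_at_top by (rule eventually_conj)
  then obtain c where c: "T c < pi / 2" "c \<ge> a"
    unfolding eventually_at_top_linorder by blast
  have "\<exists>x. a \<le> x \<and> x \<le> c \<and> T x = pi / 2"
  proof (rule IVT2')
    show "continuous_on {a..c} T"
      unfolding T_def using a by (intro continuous_intros) auto
  qed (use c Ta in auto)
  then obtain b where b: "b \<ge> a" "T b = pi / 2" by blast
  then have "p0 d (- 1/2 + of_real b * \<i>) = 0"
    using a by (intro p0_eq_zero_if_sum_arctan) (auto simp: T_def)
  then have "b \<le> alpha_tilde d" by (rule p0_root_le_alpha_tilde[OF assms(1)])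
  then show False using b(1) assms(2) by linarith
qed

theorem theorem3p5:
  fixes d :: nat and f :: "complex poly" and \<alpha> :: real
  assumes "d > 0"
    and "CL_polynomial d f"
    and "palindromic_nonneg_hstar f"
    and "poly f (- 1/2 + of_real \<alpha> * \<i>) = 0"
  shows "\<alpha> \<le> alpha_tilde d"
proof (rule ccontr)
  assume "\<not> ?thesis"
  then have gt: "\<alpha> > alpha_tilde d" by simp
  then have pos: "\<alpha> > 0" using alpha_tilde_nonneg[OF assms(1)] by linarith
  define z where "z = - 1/2 + of_real \<alpha> * \<i>"
  define h where "h = (\<lambda>i. Re (coeff (hstar f) i))"
  define G where "G = (\<lambda>i. (z + of_nat d - of_nat i) gchoose d)"
  have deg: "degree f = d" and "f \<noteq> 0" using CL_polynomial_degree[OF assms(2)] by auto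
  have h: "coeff (hstar f) i = of_real (h i)" "h i \<ge> 0" if "i \<le> d" for i
    using assms(3) that unfolding palindromic_nonneg_hstar_def h_def deg
    by (metis of_real_Re)+
  have G_pos: "Re (G i / \<i> ^ d) > 0" if "i \<le> d" for i
  proof -
    define A where "A = (\<Sum>j<d. arctan ((real d - real i - real j - 1/2) / \<alpha>))"
    obtain R where R: "R > 0"
      "(z + of_real (real d - real i)) gchoose d = \<i> ^ d * of_real R * cis (- A)"
      using gbinomial_critical_line[OF pos, of "real d - real i" d] unfolding z_def A_def by metis
    \<comment> \<open>The shift \<open>d - i\<close> lies between 0 and \<open>d\<close>, and each
      arctangent increases with it; the two extreme sums are negatives of each other, so one bound
      confines \<open>A\<close> to (-pi/2, pi/2).\<close>
    have "A \<le> (\<Sum>j<d. arctan ((real d - real j - 1/2) / \<alpha>))"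
      unfolding A_def using pos by (intro sum_mono arctan_monotone' divide_right_mono) auto
    moreover have "(\<Sum>j<d. arctan ((- real j - 1/2) / \<alpha>)) \<le> A"
      unfolding A_def using pos that by (intro sum_mono arctan_monotone' divide_right_mono) auto
    ultimately have "- (pi / 2) < A" "A < pi / 2"
      using sum_arctan_less_above_alpha_tilde[OF assms(1) gt]
      unfolding sum_arctan_reverse sum_arctan_negate by linarith+
    then have "cos A > 0" by (intro cos_gt_zero_pi) auto
    moreover have "G i / \<i> ^ d = of_real R * cis (- A)"
      using R(2) by (simp add: G_def algebra_simps)
    ultimately show ?thesis using R(1) by simp
  qed
  have "0 = poly f z / \<i> ^ d" using assms(4) by (simp add: z_def)
  also have "\<dots> = (\<Sum>i\<le>d. of_real (h i) * (G i / \<i> ^ d))"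
    unfolding poly_eq_sum_hstar[of f z] deg sum_divide_distrib
    by (intro sum.cong refl) (simp add: h G_def)
  finally have "0 = Re (\<Sum>i\<le>d. of_real (h i) * (G i / \<i> ^ d))" by simp
  then have zero: "(\<Sum>i\<le>d. h i * Re (G i / \<i> ^ d)) = 0"
    by (simp only: Re_sum Re_complex_of_real Im_complex_of_real times_complex.simps mult_zero_left diff_zero)
  \<comment> \<open>A vanishing sum of nonnegative terms with positive weights has zero
    coefficients, which would make \<open>f\<close> the zero polynomial.\<close>
  have "h i = 0" if "i \<le> d" for i
  proof -
    have "\<forall>i\<in>{..d}. h i * Re (G i / \<i> ^ d) = 0"
      using zero h(2) G_pos by (subst (asm) sum_nonneg_eq_0_iff) (auto simp: less_imp_le)
    then show ?thesis using that G_pos[OF that] by auto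
  qed
  then have "poly f w = 0" for w
    using h(1) by (simp add: poly_eq_sum_hstar[of f w] deg)
  then show False using \<open>f \<noteq> 0\<close> poly_all_0_iff_0 by blast
qed

end
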